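(* For a prime power $q$ and a non-negative integer $n$, let $\mathcal{M}_{q,n}$ denote the set of isomorphism classes of $q$-matroids on the vector space $\mathbb{F}_q^n$. If $n=n_1+n_2$ with $n_1,n_2$ non-negative integers, then $$|\mathcal{M}_{q,n}|\geq|\mathcal{M}_{q,n_1}|\cdot|\mathcal{M}_{q,n_2}|.$$
   Context: A $q$-matroid on a finite-dimensional $\mathbb{F}_q$-space $E$ is a pair $M=(E,r)$ where $r$ is an integer-valued function on the set of subspaces of $E$ with (R1) $0\le r(A)\le\dim(A)$; (R2) $A\le B\Rightarrow r(A)\le r(B)$; (R3) $r(A+B)+r(A\cap B)\le r(A)+r(B)$, for all subspaces $A,B$. Two $q$-matroids $(E_1,r_1)$ and $(E_2,r_2)$ are isomorphic if there is an $\mathbb{F}_q$-linear isomorphism $\tau:E_1\to E_2$ with $r_2(\tau(V))=r_1(V)$ for all $V\le E_1$. *)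

theory Defs
  imports Complex_Main "HOL-Library.FuncSet" "HOL-Library.Function_Algebras"
    "HOL-Library.Set_Algebras" "HOL-Library.Cardinality"
begin

locale finite_field_space = vector_space scale
  for scale :: "'a::{field,finite} \<Rightarrow> 'b::ab_group_add \<Rightarrow> 'b"
begin

definition subspaces_of :: "'b set \<Rightarrow> 'b set set" where
  "subspaces_of E = {A. subspace A \<and> A \<subseteq> E}"

text \<open>
  The ground space is a finite-dimensional subspace \<open>E\<close> of the ambient space. A rank function lives
  on the subspaces of \<open>E\<close> only; \<^const>\<open>extensional\<close> fixes its (meaningless) values elsewhere, so
  that distinct HOL functions are distinct \<open>q\<close>-matroids. \<open>A + B\<close> is the sum of subspaces,
  \<open>{a + b | a \<in> A, b \<in> B}\<close>.
\<close>

definition q_matroid :: "'b set \<Rightarrow> ('b set \<Rightarrow> int) \<Rightarrow> bool" where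
  "q_matroid E r \<longleftrightarrow>
     (\<exists>B. finite B \<and> E = span B) \<and>
     r \<in> extensional (subspaces_of E) \<and>
     (\<forall>A\<in>subspaces_of E. 0 \<le> r A \<and> r A \<le> int (dim A)) \<and>
     (\<forall>A\<in>subspaces_of E. \<forall>B\<in>subspaces_of E. A \<subseteq> B \<longrightarrow> r A \<le> r B) \<and>
     (\<forall>A\<in>subspaces_of E. \<forall>B\<in>subspaces_of E. r (A + B) + r (A \<inter> B) \<le> r A + r B)"

definition linear_iso_betw :: "('b \<Rightarrow> 'b) \<Rightarrow> 'b set \<Rightarrow> 'b set \<Rightarrow> bool" where
  "linear_iso_betw \<tau> E1 E2 \<longleftrightarrow>
     bij_betw \<tau> E1 E2 \<and>
     (\<forall>x\<in>E1. \<forall>y\<in>E1. \<tau> (x + y) = \<tau> x + \<tau> y) \<and>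
     (\<forall>c. \<forall>x\<in>E1. \<tau> (scale c x) = scale c (\<tau> x))"

definition q_matroid_isomorphic ::
    "'b set \<Rightarrow> ('b set \<Rightarrow> int) \<Rightarrow> 'b set \<Rightarrow> ('b set \<Rightarrow> int) \<Rightarrow> bool" where
  "q_matroid_isomorphic E1 r1 E2 r2 \<longleftrightarrow>
     (\<exists>\<tau>. linear_iso_betw \<tau> E1 E2 \<and> (\<forall>V\<in>subspaces_of E1. r2 (\<tau> ` V) = r1 V))"

definition q_matroid_iso_classes :: "'b set \<Rightarrow> ('b set \<Rightarrow> int) set set" where
  "q_matroid_iso_classes E =
     {r. q_matroid E r} //
     {(r1, r2). q_matroid E r1 \<and> q_matroid E r2 \<and> q_matroid_isomorphic E r1 E r2}"

lemma linear_iso_betw_image_subspaces: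
  assumes "linear_iso_betw \<tau> E1 E2" and "V \<in> subspaces_of E1"
  shows "\<tau> ` V \<in> subspaces_of E2"
proof -
  have b: "bij_betw \<tau> E1 E2"
    and a: "\<And>x y. x \<in> E1 \<Longrightarrow> y \<in> E1 \<Longrightarrow> \<tau> (x + y) = \<tau> x + \<tau> y"
    and s: "\<And>c x. x \<in> E1 \<Longrightarrow> \<tau> (scale c x) = scale c (\<tau> x)"
    using assms(1) by (auto simp: linear_iso_betw_def)
  have V: "subspace V" "V \<subseteq> E1" using assms(2) by (auto simp: subspaces_of_def)
  have 0: "0 \<in> V" using V(1) by (rule subspace_0)
  then have "\<tau> 0 = 0" using s[of 0 0] V(2) by auto
  then have z: "0 \<in> \<tau> ` V" using 0 by force
  have "subspace (\<tau> ` V)"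
  proof (rule subspaceI[OF z])
    fix x y assume "x \<in> \<tau> ` V" "y \<in> \<tau> ` V"
    then obtain u v where "u \<in> V" "v \<in> V" "x = \<tau> u" "y = \<tau> v" by auto
    then show "x + y \<in> \<tau> ` V"
      using a[of u v] V subspace_add[OF V(1), of u v] by (metis imageI subsetD)
  next
    fix c x assume "x \<in> \<tau> ` V"
    then obtain u where "u \<in> V" "x = \<tau> u" by auto
    then show "scale c x \<in> \<tau> ` V"
      using s[of u c] V subspace_scale[OF V(1), of u c] by (metis imageI subsetD)
  qed
  moreover have "\<tau> ` V \<subseteq> E2" using b V(2) by (auto simp: bij_betw_def)
  ultimately show ?thesis by (simp add: subspaces_of_def)
qed

lemma equiv_q_matroid_isomorphic:
  "equiv {r. q_matroid E r}
     {(r1, r2). q_matroid E r1 \<and> q_matroid E r2 \<and> q_matroid_isomorphic E r1 E r2}"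
proof (rule equivI)
  have "q_matroid_isomorphic E r E r" for r
    unfolding q_matroid_isomorphic_def linear_iso_betw_def
    by (rule exI[of _ id]) simp
  then show "refl_on {r. q_matroid E r}
     {(r1, r2). q_matroid E r1 \<and> q_matroid E r2 \<and> q_matroid_isomorphic E r1 E r2}"
    by (auto simp: refl_on_def)
next
  have "q_matroid_isomorphic E r2 E r1"
    if q: "q_matroid E r1" and i: "q_matroid_isomorphic E r1 E r2" for r1 r2
  proof -
    obtain \<tau> where t: "linear_iso_betw \<tau> E E"
      and r: "\<And>V. V \<in> subspaces_of E \<Longrightarrow> r2 (\<tau> ` V) = r1 V"
      using i by (auto simp: q_matroid_isomorphic_def)
    define \<sigma> where "\<sigma> = inv_into E \<tau>"
    have E: "subspace E" using q by (auto simp: q_matroid_def)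
    have b: "bij_betw \<tau> E E" using t by (simp add: linear_iso_betw_def)
    have b': "bij_betw \<sigma> E E" unfolding \<sigma>_def using b by (rule bij_betw_inv_into)
    have st: "\<tau> (\<sigma> x) = x" "\<sigma> x \<in> E" if "x \<in> E" for x
      using b that b' by (auto simp: \<sigma>_def bij_betw_inv_into_right bij_betwE)
    have ts: "\<sigma> (\<tau> x) = x" if "x \<in> E" for x
      using b that by (auto simp: \<sigma>_def bij_betw_inv_into_left)
    have "\<sigma> (x + y) = \<sigma> x + \<sigma> y" if "x \<in> E" "y \<in> E" for x y
    proof -
      have "\<tau> (\<sigma> x + \<sigma> y) = x + y" using t st that by (simp add: linear_iso_betw_def)
      then show ?thesis using ts[of "\<sigma> x + \<sigma> y"] st that subspace_add[OF E] by metis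
    qed
    moreover have "\<sigma> (scale c x) = scale c (\<sigma> x)" if "x \<in> E" for c x
    proof -
      have "\<tau> (scale c (\<sigma> x)) = scale c x" using t st that by (simp add: linear_iso_betw_def)
      then show ?thesis using ts[of "scale c (\<sigma> x)"] st that subspace_scale[OF E] by metis
    qed
    ultimately have s: "linear_iso_betw \<sigma> E E" using b' by (simp add: linear_iso_betw_def)
    have "r1 (\<sigma> ` V) = r2 V" if V: "V \<in> subspaces_of E" for V
    proof -
      have "\<tau> ` \<sigma> ` V = V" using st(1) V by (force simp: subspaces_of_def)
      then show ?thesis using r[OF linear_iso_betw_image_subspaces[OF s V]] by simp
    qed
    then show ?thesis using s by (auto simp: q_matroid_isomorphic_def)
  qed
  then show "sym {(r1, r2). q_matroid E r1 \<and> q_matroid E r2 \<and> q_matroid_isomorphic E r1 E r2}"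
    by (auto simp: sym_def)
next
  have "q_matroid_isomorphic E r1 E r3"
    if "q_matroid_isomorphic E r1 E r2" "q_matroid_isomorphic E r2 E r3" for r1 r2 r3
  proof -
    obtain \<tau> \<sigma> where t: "linear_iso_betw \<tau> E E" and s: "linear_iso_betw \<sigma> E E"
      and r: "\<And>V. V \<in> subspaces_of E \<Longrightarrow> r2 (\<tau> ` V) = r1 V"
             "\<And>V. V \<in> subspaces_of E \<Longrightarrow> r3 (\<sigma> ` V) = r2 V"
      using \<open>q_matroid_isomorphic E r1 E r2\<close> \<open>q_matroid_isomorphic E r2 E r3\<close>
      by (auto simp: q_matroid_isomorphic_def)
    have "bij_betw (\<sigma> \<circ> \<tau>) E E"
      using t s bij_betw_trans[of \<tau> E E \<sigma> E] by (simp add: linear_iso_betw_def)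
    moreover have "\<tau> x \<in> E" if "x \<in> E" for x
      using t that bij_betwE[of \<tau> E E] by (simp add: linear_iso_betw_def)
    ultimately have "linear_iso_betw (\<sigma> \<circ> \<tau>) E E"
      using t s by (simp add: linear_iso_betw_def)
    moreover have "\<forall>V\<in>subspaces_of E. r3 ((\<sigma> \<circ> \<tau>) ` V) = r1 V"
      using r linear_iso_betw_image_subspaces[OF t] by (unfold image_comp[symmetric]) simp
    ultimately show ?thesis by (auto simp: q_matroid_isomorphic_def)
  qed
  then show "trans {(r1, r2). q_matroid E r1 \<and> q_matroid E r2 \<and> q_matroid_isomorphic E r1 E r2}"
    unfolding trans_def by blast
qed auto

lemma finite_q_matroid_iso_classes:
  assumes "finite E"
  shows "finite (q_matroid_iso_classes E)"
proof -
  have fs: "finite (subspaces_of E)"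
    using assms by (auto simp: subspaces_of_def intro: finite_subset[of _ "Pow E"])
  have "{r. q_matroid E r} \<subseteq> (\<Pi>\<^sub>E A\<in>subspaces_of E. {0..int (dim A)})"
    by (auto simp: q_matroid_def PiE_def)
  then have "finite {r. q_matroid E r}"
    using fs finite_PiE[OF fs] finite_subset by (metis finite_atLeastAtMost_int)
  then show ?thesis
    unfolding q_matroid_iso_classes_def by (rule finite_quotient) auto
qed

end

text \<open>
  \<open>F^n\<close>, for an arbitrary natural number \<open>n\<close>, is realised as the space of sequences supported on
  \<open>{0..<n}\<close> inside the space of all sequences with pointwise operations.
\<close>

definition seq_scale :: "'a::{field,finite} \<Rightarrow> (nat \<Rightarrow> 'a) \<Rightarrow> nat \<Rightarrow> 'a" where
  "seq_scale c v = (\<lambda>i. c * v i)"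

interpretation seq: finite_field_space seq_scale
  by standard (auto simp: seq_scale_def fun_eq_iff algebra_simps)

definition coord_space :: "nat \<Rightarrow> (nat \<Rightarrow> 'a::{field,finite}) set" where
  "coord_space n = {v. \<forall>i\<ge>n. v i = 0}"

lemma coord_space_eq_span:
  "\<exists>B :: (nat \<Rightarrow> 'a::{field,finite}) set. finite B \<and> coord_space n = seq.span B"
proof -
  define e :: "nat \<Rightarrow> nat \<Rightarrow> 'a" where "e i = (\<lambda>j. if j = i then 1 else 0)" for i
  have sub: "seq.subspace (coord_space n :: (nat \<Rightarrow> 'a) set)"
    by (auto simp: seq.subspace_def coord_space_def seq_scale_def)
  have "v \<in> seq.span (e ` {..<n})" if "v \<in> coord_space n" for v
    using that
  proof (induction n arbitrary: v)
    case 0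
    have "v i = 0" for i using 0 by (simp add: coord_space_def)
    then have "v = 0" by (simp add: fun_eq_iff)
    then show ?case by (metis seq.span_zero)
  next
    case (Suc n)
    define w where "w = v - seq_scale (v n) (e n)"
    have "w \<in> coord_space n"
      using Suc.prems by (auto simp: w_def coord_space_def seq_scale_def e_def)
    then have "w \<in> seq.span (e ` {..<Suc n})"
      using Suc.IH seq.span_mono[of "e ` {..<n}" "e ` {..<Suc n}"] by force
    moreover have "seq_scale (v n) (e n) \<in> seq.span (e ` {..<Suc n})"
      by (intro seq.span_scale seq.span_base) auto
    ultimately have "w + seq_scale (v n) (e n) \<in> seq.span (e ` {..<Suc n})"
      by (rule seq.span_add)
    then show ?case by (simp add: w_def)
  qed
  moreover have "seq.span (e ` {..<n}) \<subseteq> coord_space n"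
    using sub by (intro seq.span_minimal) (auto simp: e_def coord_space_def)
  ultimately have "coord_space n = seq.span (e ` {..<n})" by blast
  then show ?thesis by blast
qed

lemma finite_coord_space: "finite (coord_space n :: (nat \<Rightarrow> 'a::{field,finite}) set)"
proof -
  have "(coord_space n :: (nat \<Rightarrow> 'a) set) \<subseteq> {v. {x. v x \<noteq> 0} \<subseteq> {..<n}}"
    by (auto simp: coord_space_def not_less[symmetric])
  also have "\<dots> \<subseteq> (\<lambda>f i. if i < n then f i else 0) ` ({..<n} \<rightarrow>\<^sub>E UNIV)"
    (is "_ \<subseteq> ?g ` _")
  proof
    fix v :: "nat \<Rightarrow> 'a" assume "v \<in> {v. {x. v x \<noteq> 0} \<subseteq> {..<n}}"
    then have "v = ?g (restrict v {..<n})" by (auto simp: fun_eq_iff)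
    then show "v \<in> ?g ` ({..<n} \<rightarrow>\<^sub>E UNIV)"
      by (rule image_eqI[where x = "restrict v {..<n}"]) simp
  qed
  finally show ?thesis by (rule finite_subset) (intro finite_imageI finite_PiE finite_lessThan finite)
qed

text \<open>
  The field with \<open>q\<close> elements is the type \<open>'a\<close>, so \<open>q = CARD('a)\<close> and the set below is
  \<open>\<M>\<^bsub>q,n\<^esub>\<close>.
\<close>

definition q_matroid_classes :: "'a::{field,finite} itself \<Rightarrow> nat \<Rightarrow> ((nat \<Rightarrow> 'a) set \<Rightarrow> int) set set"
  where "q_matroid_classes _ n = seq.q_matroid_iso_classes (coord_space n)"

lemma finite_q_matroid_classes: "finite (q_matroid_classes TYPE('a::{field,finite}) n)"
  unfolding q_matroid_classes_def
  by (rule seq.finite_q_matroid_iso_classes[OF finite_coord_space])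

end

theory Submission
  imports Defs
begin

text \<open>
  Given q-matroids \<open>r1\<close> on \<open>K\<close> and \<open>r2\<close> on \<open>E / K\<close>, form their free product on \<open>E\<close>. Restricting it
  to \<open>K\<close> gives back \<open>r1\<close> and contracting \<open>K\<close> gives back \<open>r2\<close>, so an isomorphism of two free
  products that fixes \<open>K\<close> induces isomorphisms of the factors. An arbitrary isomorphism moves \<open>K\<close> to
  some \<open>U\<close> of the same dimension, and both \<open>K\<close> and \<open>U\<close> are then free separators of the target. In
  that situation the rank of \<open>A\<close> depends only on \<open>dim A\<close>, \<open>A \<inter> (K \<inter> U)\<close> and \<open>A + (K + U)\<close>, so a
  linear map swapping \<open>K\<close> and \<open>U\<close> and acting trivially on \<open>K \<inter> U\<close> and \<open>E / (K + U)\<close> is an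
  automorphism, and composing with it brings \<open>U\<close> back to \<open>K\<close>.
\<close>

context finite_field_space
begin

section \<open>Sums of subspaces, and dimension read off from cardinality\<close>

lemma subspace_set_plus:
  assumes "subspace A" "subspace B"
  shows "subspace (A + B)"
proof -
  have "A + B = {x + y |x y. x \<in> A \<and> y \<in> B}" by (auto simp: set_plus_def)
  then show ?thesis using subspace_sums[OF assms] by simp
qed

lemma subset_set_plus_left:
  assumes "subspace B"
  shows "A \<subseteq> A + B"
  using subspace_0[OF assms] by (force simp: set_plus_def)

lemma subset_set_plus_right:
  assumes "subspace A"
  shows "B \<subseteq> A + B"
  using subspace_0[OF assms] by (force simp: set_plus_def)

lemma set_plus_subset: "subspace C \<Longrightarrow> A \<subseteq> C \<Longrightarrow> B \<subseteq> C \<Longrightarrow> A + B \<subseteq> C"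
  by (auto simp: set_plus_def subspace_add subset_iff)

lemma set_plus_absorb:
  assumes "subspace A" "subspace B" "B \<subseteq> A"
  shows "A + B = A"
  using assms set_plus_subset[of A A B] subset_set_plus_left[of B A] by blast

lemma span_Un_set_plus: "span (S \<union> T) = span S + span T"
  by (auto simp: span_Un set_plus_def)

text \<open>Every vector of \<open>span (insert b B)\<close> is \<open>scale c b + v\<close> for
  exactly one scalar \<open>c\<close> and one \<open>v\<close> in \<open>span B\<close>, so each
  basis vector multiplies the size by that of the field. This lets cardinalities stand in for
  dimensions of finite subspaces, while the ambient space need not be finite-dimensional.\<close>

lemma card_span_independent:
  assumes "finite B" "independent B"
  shows "finite (span B) \<and> card (span B) = CARD('a) ^ card B"
  using assms
proof (induction B rule: finite_induct)
  case empty
  then show ?case by simp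
next
  case (insert b B)
  then have ind: "independent B" and b: "b \<notin> span B"
    by (auto simp: independent_insert)
  have "inj_on (\<lambda>(c, v). scale c b + v) (UNIV \<times> span B)"
  proof (rule inj_onI, clarify)
    fix c v d w
    assume v: "v \<in> span B" and w: "w \<in> span B"
      and eq: "scale c b + v = scale d b + w"
    have "scale (c - d) b = w - v"
      using eq by (simp add: scale_left_diff_distrib algebra_simps)
    then have "scale (c - d) b \<in> span B" using span_diff[OF w v] by simp
    then have "c = d"
      using b span_scale[of "scale (c - d) b" B "inverse (c - d)"] by (cases "c = d") auto
    then show "c = d \<and> v = w" using eq by simp
  qed
  moreover have "span (insert b B) = (\<lambda>(c, v). scale c b + v) ` (UNIV \<times> span B)"
  proof (intro set_eqI iffI)
    fix x assume "x \<in> span (insert b B)"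
    then obtain k where k: "x - scale k b \<in> span B" by (auto simp: span_insert)
    then show "x \<in> (\<lambda>(c, v). scale c b + v) ` (UNIV \<times> span B)"
      by (intro image_eqI[where x = "(k, x - scale k b)"]) auto
  next
    fix x assume "x \<in> (\<lambda>(c, v). scale c b + v) ` (UNIV \<times> span B)"
    then obtain k v where "v \<in> span B" "x = scale k b + v" by auto
    then show "x \<in> span (insert b B)" by (auto simp: span_insert intro!: exI[of _ k])
  qed
  ultimately show ?case
    using insert ind by (simp add: card_image card_cartesian_product)
qed

lemma card_subspace:
  assumes "finite A" "subspace A"
  shows "card A = CARD('a) ^ dim A"
proof -
  obtain B where B: "B \<subseteq> A" "independent B" "A \<subseteq> span B" "card B = dim A"
    by (rule basis_exists)
  have "A = span B" using B assms span_minimal by blast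
  then show ?thesis
    using card_span_independent[of B] B assms finite_subset by metis
qed

lemma one_less_card_field: "1 < CARD('a)"
proof -
  have "card {0, 1 :: 'a} \<le> CARD('a)" by (rule card_mono) auto
  then show ?thesis by simp
qed

lemma dim_eq_iff_card_eq:
  assumes "finite A" "subspace A" "finite B" "subspace B"
  shows "dim A = dim B \<longleftrightarrow> card A = card B"
  using card_subspace assms one_less_card_field by simp

lemma dim_mono_finite:
  assumes "finite B" "subspace A" "subspace B" "A \<subseteq> B"
  shows "dim A \<le> dim B"
proof -
  have "card A \<le> card B" using assms card_mono by blast
  then show ?thesis
    using card_subspace[of A] card_subspace[of B] assms one_less_card_field
    by (auto dest: finite_subset)
qed

text \<open>The nonempty fibres of \<open>f\<close> on \<open>A\<close> are translates of the
  kernel, so \<open>card A\<close> is the product of the cardinalities of image and kernel.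
  Comparing exponents of the field size gives the claim.\<close>

lemma dim_rank_nullity:
  assumes f: "Vector_Spaces.linear scale scale f" and A: "finite A" "subspace A"
  shows "dim (f ` A) + dim {x \<in> A. f x = 0} = dim A"
proof -
  interpret f: Vector_Spaces.linear scale scale f by (rule f)
  let ?K = "{x \<in> A. f x = 0}"
  have sub: "subspace (f ` A)" "subspace ?K"
    using A f.subspace_image f.subspace_kernel subspace_inter[OF A(2)] by (auto simp: Collect_conj_eq)
  have fib: "card {x \<in> A. f x = y} = card ?K" if "y \<in> f ` A" for y
  proof -
    obtain a where a: "a \<in> A" "y = f a" using \<open>y \<in> f ` A\<close> by blast
    have "bij_betw (\<lambda>x. x + a) ?K {x \<in> A. f x = y}"
      by (rule bij_betw_byWitness[where f' = "\<lambda>x. x - a"])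
        (use a A in \<open>auto simp: f.add f.diff subspace_add subspace_diff\<close>)
    then show ?thesis by (rule bij_betw_same_card[symmetric])
  qed
  have "card A = (\<Sum>y\<in>f ` A. card {x \<in> A. f x = y})"
    using A sum.image_gen[of A "\<lambda>_. 1 :: nat" f] by simp
  also have "\<dots> = card (f ` A) * card ?K" using fib by simp
  finally have "CARD('a) ^ dim A = CARD('a) ^ (dim (f ` A) + dim ?K)"
    using sub A card_subspace[of A] card_subspace[of "f ` A"] card_subspace[of ?K]
    by (simp add: power_add)
  then show ?thesis using one_less_card_field by simp
qed

text \<open>Extend a basis \<open>w\<close> of \<open>U \<inter> V\<close> to one of
  \<open>U\<close>, then add vectors of \<open>V\<close> until \<open>V\<close> is spanned too.
  Write \<open>x\<close> in \<open>V\<close> as \<open>s + t\<close> with \<open>s\<close> in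
  \<open>U\<close> and \<open>t\<close> in the span of the last vectors; then
  \<open>s = x - t\<close> lies in \<open>U \<inter> V\<close>, so \<open>w\<close> and the last
  vectors already span \<open>V\<close>.\<close>

lemma basis_of_pair:
  assumes "subspace U" "subspace V"
  obtains w u v where "independent (w \<union> u \<union> v)" "w \<inter> u = {}" "(w \<union> u) \<inter> v = {}"
    "span w = U \<inter> V" "span (w \<union> u) = U" "span (w \<union> v) = V"
proof -
  obtain w where w: "w \<subseteq> U \<inter> V" "independent w" "U \<inter> V \<subseteq> span w"
    using maximal_independent_subset by blast
  have sw: "span w = U \<inter> V" using w assms by (intro span_subspace subspace_inter) auto
  obtain b where b: "w \<subseteq> b" "b \<subseteq> U" "independent b" "U \<subseteq> span b"
    using maximal_independent_subset_extend[of w U] w by blast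
  have sb: "span b = U" using b assms by (intro span_subspace) auto
  obtain c where c: "b \<subseteq> c" "c \<subseteq> b \<union> V" "independent c" "b \<union> V \<subseteq> span c"
    using maximal_independent_subset_extend[of b "b \<union> V"] b by blast
  let ?v = "c - b"
  have "V \<subseteq> span (w \<union> ?v)"
  proof
    fix x assume x: "x \<in> V"
    have "x \<in> span (b \<union> ?v)" using x c by (metis Un_Diff_cancel le_sup_iff subset_Un_eq subset_iff)
    then obtain s t where st: "x = s + t" "s \<in> U" "t \<in> span ?v"
      unfolding span_Un sb by blast
    have "span ?v \<subseteq> V" using c assms by (intro span_minimal) auto
    then have "x - t \<in> V" using x st assms subspace_diff by blast
    then have "s \<in> span w" using st sw by simp
    then show "x \<in> span (w \<union> ?v)" using st by (auto simp: span_Un)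
  qed
  then have "span (w \<union> ?v) = V" using w c assms by (intro span_subspace) auto
  moreover have "w \<union> (b - w) = b" "b \<union> ?v = c" using b c by auto
  ultimately show ?thesis using that[of w "b - w" ?v] sw sb c(3) by auto
qed

lemma dim_set_plus_Int:
  assumes "finite U" "finite V" "subspace U" "subspace V"
  shows "dim (U + V) + dim (U \<inter> V) = dim U + dim V"
proof -
  obtain w u v where *: "independent (w \<union> u \<union> v)" "w \<inter> u = {}" "(w \<union> u) \<inter> v = {}"
    "span w = U \<inter> V" "span (w \<union> u) = U" "span (w \<union> v) = V"
    using basis_of_pair[OF assms(3,4)] by blast
  have "w \<union> u \<subseteq> U" "w \<union> v \<subseteq> V" using *(5,6) span_superset by blast+
  then have fin: "finite w" "finite u" "finite v" using assms finite_subset by auto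
  have "span (w \<union> u \<union> v) = U + V"
  proof -
    have "span (w \<union> u \<union> v) = span ((w \<union> u) \<union> (w \<union> v))" by (simp add: Un_ac)
    then show ?thesis using * by (simp only: span_Un_set_plus[of "w \<union> u" "w \<union> v"])
  qed
  moreover have "independent w" "independent (w \<union> u)" "independent (w \<union> v)"
    using *(1) by (auto elim!: independent_mono)
  ultimately have "dim (U + V) = card (w \<union> u \<union> v)" "dim (U \<inter> V) = card w"
    "dim U = card (w \<union> u)" "dim V = card (w \<union> v)"
    using * by (metis dim_span_eq_card_independent)+
  then show ?thesis using fin *(2,3)
    by (simp add: card_Un_disjoint Int_Un_distrib2)
qed

lemma subspace_complement:
  assumes "finite Y" "subspace X" "subspace Y" "X \<subseteq> Y"
  obtains C where "subspace C" "C \<subseteq> Y" "X + C = Y" "dim X + dim C = dim Y"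
proof -
  obtain w where w: "w \<subseteq> X" "independent w" "X \<subseteq> span w"
    using maximal_independent_subset by blast
  have sw: "span w = X" using w assms by (intro span_subspace) auto
  obtain b where b: "w \<subseteq> b" "b \<subseteq> Y" "independent b" "Y \<subseteq> span b"
    using maximal_independent_subset_extend[of w Y] w assms by blast
  have sb: "span b = Y" using b assms by (intro span_subspace) auto
  have "X + span (b - w) = Y"
    using sw sb b(1) span_Un_set_plus[of w "b - w"] by (simp add: Un_absorb1)
  moreover have "span (b - w) \<subseteq> Y" using sb span_mono[of "b - w" b] by auto
  moreover have "dim X + dim (span (b - w)) = dim Y"
  proof -
    have "independent (b - w)" using b(3) by (rule independent_mono) auto
    then have "dim (span (b - w)) = card (b - w)" "dim X = card w" "dim Y = card b"
      using sw sb w b by (metis dim_span_eq_card_independent)+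
    moreover have "finite b" using b(2) assms(1) finite_subset by blast
    ultimately show ?thesis using b(1) by (simp add: card_Diff_subset card_mono finite_subset)
  qed
  ultimately show ?thesis using that[of "span (b - w)"] by simp
qed

section \<open>Rank, nullity and closure in a q-matroid\<close>

lemma subspaces_of_iff: "A \<in> subspaces_of E \<longleftrightarrow> subspace A \<and> A \<subseteq> E"
  by (simp add: subspaces_of_def)

lemma subspaces_of_Int: "A \<in> subspaces_of E \<Longrightarrow> B \<in> subspaces_of E \<Longrightarrow> A \<inter> B \<in> subspaces_of E"
  by (auto simp: subspaces_of_iff subspace_inter)

lemma subspaces_of_plus:
  assumes "subspace E" "A \<in> subspaces_of E" "B \<in> subspaces_of E"
  shows "A + B \<in> subspaces_of E"
  using assms set_plus_subset[of E A B] by (simp add: subspaces_of_iff subspace_set_plus)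

lemma q_matroid_finite:
  assumes "q_matroid E r"
  shows "finite E" "subspace E"
proof -
  obtain S where S: "finite S" "E = span S" using assms by (auto simp: q_matroid_def)
  obtain B where B: "B \<subseteq> S" "independent B" "S \<subseteq> span B"
    using maximal_independent_subset by blast
  then have "span B = E"
    using S(2) span_mono[of B S] span_minimal[of S "span B"] by auto
  then show "finite E" "subspace E"
    using card_span_independent[OF finite_subset[OF B(1) S(1)] B(2)] S(2) by auto
qed

lemma q_matroidI:
  assumes "finite E" "subspace E" "r \<in> extensional (subspaces_of E)"
    and "\<And>A. A \<in> subspaces_of E \<Longrightarrow> 0 \<le> r A"
    and "\<And>A. A \<in> subspaces_of E \<Longrightarrow> r A \<le> int (dim A)"
    and "\<And>A B. A \<in> subspaces_of E \<Longrightarrow> B \<in> subspaces_of E \<Longrightarrow> A \<subseteq> B \<Longrightarrow> r A \<le> r B"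
    and "\<And>A B. A \<in> subspaces_of E \<Longrightarrow> B \<in> subspaces_of E \<Longrightarrow> r (A + B) + r (A \<inter> B) \<le> r A + r B"
  shows "q_matroid E r"
  unfolding q_matroid_def
proof (intro conjI ballI impI)
  have "E = span E" using assms(2) span_eq_iff by metis
  then show "\<exists>B. finite B \<and> E = span B" using assms(1) by blast
qed (use assms(3-) in auto)

lemma q_matroid_nonneg: "q_matroid E r \<Longrightarrow> A \<in> subspaces_of E \<Longrightarrow> 0 \<le> r A"
  and q_matroid_le_dim: "q_matroid E r \<Longrightarrow> A \<in> subspaces_of E \<Longrightarrow> r A \<le> int (dim A)"
  and q_matroid_mono: "q_matroid E r \<Longrightarrow> A \<in> subspaces_of E \<Longrightarrow> B \<in> subspaces_of E \<Longrightarrow>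
    A \<subseteq> B \<Longrightarrow> r A \<le> r B"
  and q_matroid_submodular: "q_matroid E r \<Longrightarrow> A \<in> subspaces_of E \<Longrightarrow> B \<in> subspaces_of E \<Longrightarrow>
    r (A + B) + r (A \<inter> B) \<le> r A + r B"
  by (simp_all add: q_matroid_def)

lemma q_matroid_dim_modular:
  assumes "q_matroid E r" "A \<in> subspaces_of E" "B \<in> subspaces_of E"
  shows "int (dim (A + B)) + int (dim (A \<inter> B)) = int (dim A) + int (dim B)"
proof -
  have "finite A" "finite B"
    using assms q_matroid_finite(1)[OF assms(1)] by (auto simp: subspaces_of_iff intro: finite_subset)
  then show ?thesis using dim_set_plus_Int[of A B] assms by (simp add: subspaces_of_iff flip: of_nat_add)
qed

text \<open>Take a complement \<open>C\<close> of \<open>X\<close> in \<open>Y\<close>. By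
  submodularity, adding it to \<open>X\<close> raises the rank by at most \<open>r C\<close>, hence
  by at most \<open>dim C\<close>, which is the increase of the dimension.\<close>

lemma q_matroid_nullity_mono:
  assumes r: "q_matroid E r" and X: "X \<in> subspaces_of E" and Y: "Y \<in> subspaces_of E" and "X \<subseteq> Y"
  shows "int (dim X) - r X \<le> int (dim Y) - r Y"
proof -
  have "finite Y" using Y q_matroid_finite(1)[OF r] by (auto simp: subspaces_of_iff intro: finite_subset)
  then obtain C where C: "subspace C" "C \<subseteq> Y" "X + C = Y" "dim X + dim C = dim Y"
    using subspace_complement[of Y X] X Y \<open>X \<subseteq> Y\<close> by (auto simp: subspaces_of_iff)
  then have Cs: "C \<in> subspaces_of E" using Y by (auto simp: subspaces_of_iff)
  have "r Y + r (X \<inter> C) \<le> r X + r C" using q_matroid_submodular[OF r X Cs] C by simp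
  moreover have "0 \<le> r (X \<inter> C)" using q_matroid_nonneg[OF r] subspaces_of_Int[OF X Cs] by blast
  moreover have "r C \<le> int (dim C)" using q_matroid_le_dim[OF r Cs] .
  ultimately show ?thesis using C(4) by linarith
qed

text \<open>The hypothesis \<open>r Y \<le> r X\<close> puts \<open>Y\<close> into the closure of
  \<open>X\<close>, hence into that of any \<open>A\<close> above \<open>X\<close>. Submodularity
  for \<open>A\<close> and \<open>Y\<close> proves it, as \<open>A \<inter> Y\<close> still contains
  \<open>X\<close>.\<close>

lemma q_matroid_rank_closure:
  assumes r: "q_matroid E r" and XYA: "X \<in> subspaces_of E" "Y \<in> subspaces_of E" "A \<in> subspaces_of E"
    and "X \<subseteq> Y" "X \<subseteq> A" "r Y \<le> r X"
  shows "r (A + Y) = r A"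
proof -
  have s: "subspace E" using q_matroid_finite[OF r] by simp
  have "r (A + Y) + r (A \<inter> Y) \<le> r A + r Y" using q_matroid_submodular[OF r XYA(3,2)] .
  moreover have "r X \<le> r (A \<inter> Y)"
    using q_matroid_mono[OF r XYA(1) subspaces_of_Int[OF XYA(3,2)]] assms(5,6) by simp
  moreover have "r A \<le> r (A + Y)"
    using q_matroid_mono[OF r XYA(3) subspaces_of_plus[OF s XYA(3,2)]] XYA subset_set_plus_left
    by (auto simp: subspaces_of_iff)
  ultimately show ?thesis using assms by linarith
qed

text \<open>The counterpart of \<open>q_matroid_rank_closure\<close> for nullity. Nullity is
  supermodular, as dimension is modular and rank submodular. Applied to \<open>A \<inter> Y\<close>
  and \<open>X\<close>, whose sum lies in \<open>Y\<close> and so has no more nullity than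
  \<open>X\<close>, this bounds the nullity of \<open>A \<inter> Y\<close> by that of
  \<open>A \<inter> X\<close>.\<close>

lemma q_matroid_nullity_Int:
  assumes r: "q_matroid E r" and XYA: "X \<in> subspaces_of E" "Y \<in> subspaces_of E" "A \<in> subspaces_of E"
    and "X \<subseteq> Y" and "int (dim Y) - r Y \<le> int (dim X) - r X"
  shows "int (dim (A \<inter> Y)) - r (A \<inter> Y) = int (dim (A \<inter> X)) - r (A \<inter> X)"
proof -
  have s: "subspace E" using q_matroid_finite[OF r] by simp
  let ?B = "A \<inter> Y"
  have B: "?B \<in> subspaces_of E" "A \<inter> X \<in> subspaces_of E" "?B \<inter> X = A \<inter> X"
    using XYA subspaces_of_Int \<open>X \<subseteq> Y\<close> by auto
  have BX: "?B + X \<in> subspaces_of E" "?B + X \<subseteq> Y"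
    using subspaces_of_plus[OF s B(1) XYA(1)] set_plus_subset[of Y ?B X] XYA \<open>X \<subseteq> Y\<close>
    by (auto simp: subspaces_of_iff)
  have "r (?B + X) + r (A \<inter> X) \<le> r ?B + r X"
    using q_matroid_submodular[OF r B(1) XYA(1)] B(3) by simp
  moreover have "int (dim (?B + X)) + int (dim (A \<inter> X)) = int (dim ?B) + int (dim X)"
    using q_matroid_dim_modular[OF r B(1) XYA(1)] B(3) by simp
  moreover have "int (dim (?B + X)) - r (?B + X) \<le> int (dim Y) - r Y"
    using q_matroid_nullity_mono[OF r BX(1) XYA(2) BX(2)] .
  moreover have "int (dim (A \<inter> X)) - r (A \<inter> X) \<le> int (dim ?B) - r ?B"
    using q_matroid_nullity_mono[OF r B(2,1)] \<open>X \<subseteq> Y\<close> by auto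
  ultimately show ?thesis using assms by linarith
qed

section \<open>Free separators and the rank formula for a pair of them\<close>

text \<open>The q-analogue of a free separator: exactly the subspaces \<open>U\<close> for which \<open>r\<close> is the free
  product of its restriction to \<open>U\<close> and its contraction by \<open>U\<close>.\<close>

definition free_separator :: "'b set \<Rightarrow> ('b set \<Rightarrow> int) \<Rightarrow> 'b set \<Rightarrow> bool" where
  "free_separator E r U \<longleftrightarrow> U \<in> subspaces_of E \<and>
     (\<forall>A\<in>subspaces_of E. r A = min (r (A \<inter> U) + int (dim A) - int (dim (A \<inter> U))) (r (A + U)))"

lemma free_separator_rank:
  "free_separator E r U \<Longrightarrow> A \<in> subspaces_of E \<Longrightarrow>
    r A = min (r (A \<inter> U) + int (dim A) - int (dim (A \<inter> U))) (r (A + U))"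
  unfolding free_separator_def by blast

text \<open>The term attaining the minimum decides: the first means that all nullity of
  \<open>A\<close> sits inside \<open>U\<close>, the second that \<open>U\<close> lies in the
  closure of \<open>A\<close>.\<close>

lemma free_separator_cases:
  assumes "free_separator E r U" "A \<in> subspaces_of E"
  obtains "int (dim A) - r A = int (dim (A \<inter> U)) - r (A \<inter> U)" | "r A = r (A + U)"
proof -
  have "int (dim A) - r A = int (dim (A \<inter> U)) - r (A \<inter> U) \<or> r A = r (A + U)"
    using free_separator_rank[OF assms] by linarith
  then show ?thesis using that by blast
qed

text \<open>Applying each separator to the other one shows that either both have the nullity of
  \<open>U \<inter> V\<close> or both have the rank of \<open>U + V\<close>. In the first case
  nullity, in the second closure, carries the alternatives for \<open>A\<close> with respect to
  \<open>U\<close> and \<open>V\<close> over to the pair \<open>U \<inter> V\<close>,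
  \<open>U + V\<close>.\<close>

lemma rank_of_two_free_separators:
  assumes r: "q_matroid E r" and U: "free_separator E r U" and V: "free_separator E r V"
    and dUV: "dim U = dim V" and A: "A \<in> subspaces_of E"
  shows "r A = min (r (A \<inter> (U \<inter> V)) + int (dim A) - int (dim (A \<inter> (U \<inter> V)))) (r (A + (U + V)))"
proof -
  define W X where "W = U \<inter> V" and "X = U + V"
  have s: "subspace E" using q_matroid_finite[OF r] by simp
  have Us: "U \<in> subspaces_of E" and Vs: "V \<in> subspaces_of E"
    using U V by (auto simp: free_separator_def)
  then have su: "subspace U" "subspace V" "subspace A" using A by (auto simp: subspaces_of_iff)
  have Ws: "W \<in> subspaces_of E" and Xs: "X \<in> subspaces_of E"
    unfolding W_def X_def using Us Vs s subspaces_of_Int subspaces_of_plus by auto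
  have UX: "U \<subseteq> X" "V \<subseteq> X"
    unfolding X_def using subset_set_plus_left subset_set_plus_right su by auto
  have WU: "W \<subseteq> U" "W \<subseteq> V" by (auto simp: W_def)
  let ?n = "\<lambda>A. int (dim A) - r A"
  note ints = subspaces_of_Int[OF A Ws] subspaces_of_Int[OF A Us] subspaces_of_plus[OF s A Us]
    subspaces_of_plus[OF s A Xs]
  have "?n (A \<inter> W) \<le> ?n A" using q_matroid_nullity_mono[OF r ints(1) A] by auto
  moreover have "r A \<le> r (A + X)"
    using q_matroid_mono[OF r A ints(4)] subset_set_plus_left[of X A] Xs
    by (auto simp: subspaces_of_iff)
  \<comment> \<open>Both terms of the claimed minimum bound \<open>r A\<close> from above, so it
    remains to see that one of them is attained.\<close>
  moreover have "?n A = ?n (A \<inter> W) \<or> r A = r (A + X)"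
  proof -
    have rUV: "r U = min (r W + int (dim U) - int (dim W)) (r X)"
      "r V = min (r W + int (dim V) - int (dim W)) (r X)"
      using free_separator_rank[OF V Us] free_separator_rank[OF U Vs]
      by (simp_all add: W_def X_def Int_commute add.commute)
    \<comment> \<open>Since \<open>dim U = dim V\<close>, the two minima in \<open>rUV\<close> are
      taken over the same two numbers, so the same alternative holds for \<open>U\<close> and
      \<open>V\<close>.\<close>
    consider "?n U = ?n W" "?n V = ?n W" | "r U = r X" "r V = r X"
      using rUV dUV by linarith
    then show ?thesis
    proof cases
      case 1
      from U A show ?thesis
      proof (cases rule: free_separator_cases)
        case a: 1
        have "?n (A \<inter> U) = ?n (A \<inter> W)"
          using q_matroid_nullity_Int[OF r Ws Us A WU(1)] 1 by simp
        then show ?thesis using a by simp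
      next
        case a: 2
        let ?C = "A + U"
        have UC: "U \<subseteq> ?C" "A \<subseteq> ?C" using subset_set_plus_left subset_set_plus_right su by auto
        from V ints(3) show ?thesis
        proof (cases rule: free_separator_cases)
          case b: 1
          \<comment> \<open>\<open>?C\<close> has no more nullity than \<open>V\<close>, hence than
            \<open>W\<close>. So \<open>q_matroid_nullity_Int\<close> applies to \<open>W\<close>
            inside \<open>?C\<close>, and \<open>A \<inter> ?C\<close> is \<open>A\<close>.\<close>
          have "?n (?C \<inter> V) \<le> ?n V"
            using q_matroid_nullity_mono[OF r subspaces_of_Int[OF ints(3) Vs] Vs] by auto
          then have "?n ?C \<le> ?n W" using b 1 by linarith
          then have "?n (A \<inter> ?C) = ?n (A \<inter> W)"
            using q_matroid_nullity_Int[OF r Ws ints(3) A] WU UC by auto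
          then show ?thesis using UC(2) by (simp add: Int_absorb2)
        next
          case b: 2
          then show ?thesis using a by (simp add: X_def add.assoc)
        qed
      qed
    next
      case 2
      from U A show ?thesis
      proof (cases rule: free_separator_cases)
        case a: 1
        let ?B = "A \<inter> U"
        from V ints(2) show ?thesis
        proof (cases rule: free_separator_cases)
          case b: 1
          then show ?thesis using a by (simp add: W_def Int_assoc)
        next
          case b: 2
          \<comment> \<open>\<open>?B\<close> is contained in \<open>X\<close> and has at least its
            rank, so \<open>X\<close> lies in the closure of \<open>?B\<close>, hence in that of
            \<open>A\<close>.\<close>
          have "r V \<le> r (?B + V)"
            using q_matroid_mono[OF r Vs subspaces_of_plus[OF s ints(2) Vs]]
              subset_set_plus_right[of ?B V] su subspace_inter by auto
          then have "r X \<le> r ?B" using b 2 by linarith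
          then show ?thesis
            using q_matroid_rank_closure[OF r ints(2) Xs A] UX(1) by (simp add: le_infI2)
        qed
      next
        case a: 2
        have UC: "U \<subseteq> A + U" using subset_set_plus_right su by auto
        have "r ((A + U) + X) = r (A + U)"
          using q_matroid_rank_closure[OF r Us Xs ints(3) UX(1) UC] 2 by simp
        moreover have "(A + U) + X = A + X"
          using set_plus_absorb[of X U] Xs su UX
          by (simp add: add.assoc add.commute[of U X] subspaces_of_iff)
        ultimately show ?thesis using a by simp
      qed
    qed
  qed
  ultimately show ?thesis unfolding W_def[symmetric] X_def[symmetric] by linarith
qed

section \<open>Automorphisms exchanging two free separators of equal dimension\<close>

text \<open>The map swaps bases of complements of \<open>U \<inter> V\<close> in \<open>U\<close> and in \<open>V\<close>.\<close>

lemma subspace_swap: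
  assumes "finite E" "subspace E" "U \<in> subspaces_of E" "V \<in> subspaces_of E" "dim U = dim V"
  obtains \<tau> where "Vector_Spaces.linear scale scale \<tau>" "\<And>x. x \<in> E \<Longrightarrow> \<tau> (\<tau> x) = x"
    "\<And>x. x \<in> U \<inter> V \<Longrightarrow> \<tau> x = x" "\<And>x. x \<in> E \<Longrightarrow> \<tau> x - x \<in> U + V" "\<tau> ` U = V"
proof -
  have su: "subspace U" "subspace V" "U \<subseteq> E" "V \<subseteq> E" using assms by (auto simp: subspaces_of_iff)
  obtain w u v where b: "independent (w \<union> u \<union> v)" "w \<inter> u = {}" "(w \<union> u) \<inter> v = {}"
    "span w = U \<inter> V" "span (w \<union> u) = U" "span (w \<union> v) = V"
    using basis_of_pair[OF su(1,2)] by blast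
  have sub: "w \<union> u \<subseteq> U" "w \<union> v \<subseteq> V" using b(5,6) span_superset by blast+
  have fin: "finite w" "finite u" "finite v"
    using assms su sub by (meson finite_subset le_sup_iff subset_trans)+
  have "independent (w \<union> u)" "independent (w \<union> v)"
    using b(1) by (auto elim!: independent_mono)
  then have "card (w \<union> u) = card (w \<union> v)"
    using b(5,6) assms(5) by (metis dim_span_eq_card_independent)
  \<comment> \<open>Both sets complete the same \<open>w\<close> to bases of spaces of equal
    dimension.\<close>
  then have "card u = card v" using b(2,3) fin
    by (simp add: card_Un_disjoint Int_Un_distrib2)
  then obtain g where g: "bij_betw g u v" using fin finite_same_card_bij by blast
  obtain B where B: "w \<union> u \<union> v \<subseteq> B" "B \<subseteq> E" "independent B" "E \<subseteq> span B"
    using maximal_independent_subset_extend[of "w \<union> u \<union> v" E] b(1) sub su by blast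
  have sB: "span B = E" using B assms by (intro span_subspace) auto
  \<comment> \<open>Outside \<open>u\<close> and \<open>v\<close> the basis \<open>B\<close> is
    fixed, so \<open>p\<close> is an involution of \<open>B\<close> and its linear extension is one
    of \<open>E\<close>.\<close>
  define p where "p x = (if x \<in> u then g x else if x \<in> v then inv_into u g x else x)" for x
  interpret pr: vector_space_pair scale scale by unfold_locales
  define \<tau> where "\<tau> = pr.construct B p"
  have lin: "Vector_Spaces.linear scale scale \<tau>"
    unfolding \<tau>_def by (rule pr.linear_construct[OF B(3)])
  interpret t: Vector_Spaces.linear scale scale \<tau> by (rule lin)
  have tp: "\<tau> x = p x" if "x \<in> B" for x
    unfolding \<tau>_def using pr.construct_basis[OF B(3) that] .
  have gu: "g x \<in> v" if "x \<in> u" for x using g that bij_betwE by blast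
  have gv: "inv_into u g x \<in> u" "g (inv_into u g x) = x" if "x \<in> v" for x
    using g that bij_betw_inv_into_right bij_betwE[OF bij_betw_inv_into[OF g]] by metis+
  have gg: "inv_into u g (g x) = x" if "x \<in> u" for x
    using g that bij_betw_inv_into_left by metis
  have uv: "u \<inter> v = {}" using b(3) by auto
  have pB: "p x \<in> B" "p (p x) = x" if "x \<in> B" for x
    using that gu gv gg uv B(1) by (auto simp: p_def)
  have inv: "\<tau> (\<tau> x) = x" if "x \<in> E" for x
  proof -
    have "(\<tau> \<circ> \<tau>) x = id x"
      by (rule pr.linear_eq_on[OF Vector_Spaces.linear_compose[OF lin lin] linear_id, of x B])
        (use that sB tp pB in auto)
    then show ?thesis by simp
  qed
  have pw': "p x = x" if "x \<in> w" for x
    using that b(2,3) by (auto simp: p_def)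
  have fix_w: "\<tau> x = x" if "x \<in> U \<inter> V" for x
  proof -
    have "\<tau> x = id x"
      by (rule pr.linear_eq_on[OF lin linear_id, of x w])
        (use that b(4) tp pw' B(1) in auto)
    then show ?thesis by simp
  qed
  have UV: "subspace (U + V)" "U \<subseteq> U + V" "V \<subseteq> U + V"
    using su subspace_set_plus subset_set_plus_left subset_set_plus_right by auto
  have mod: "\<tau> x - x \<in> U + V" if "x \<in> E" for x
  proof -
    \<comment> \<open>The vectors that \<open>\<tau>\<close> displaces by an element of
      \<open>U + V\<close> form a subspace, so checking the basis \<open>B\<close> is
      enough.\<close>
    have "subspace {x. \<tau> x - x \<in> U + V}"
    proof (rule subspaceI)
      show "0 \<in> {x. \<tau> x - x \<in> U + V}" using subspace_0[OF UV(1)] by simp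
    next
      fix x y assume "x \<in> {x. \<tau> x - x \<in> U + V}" "y \<in> {x. \<tau> x - x \<in> U + V}"
      then have "(\<tau> x - x) + (\<tau> y - y) \<in> U + V" using subspace_add[OF UV(1)] by blast
      then show "x + y \<in> {x. \<tau> x - x \<in> U + V}" by (simp add: t.add algebra_simps)
    next
      fix c x assume "x \<in> {x. \<tau> x - x \<in> U + V}"
      then have "scale c (\<tau> x - x) \<in> U + V" using subspace_scale[OF UV(1)] by blast
      then show "scale c x \<in> {x. \<tau> x - x \<in> U + V}"
        by (simp add: t.scale scale_right_diff_distrib)
    qed
    moreover have "p x - x \<in> U + V" for x
    proof (cases "x \<in> u \<union> v")
      case True
      then have "p x \<in> u \<union> v" using gu gv by (auto simp: p_def)
      then have "p x \<in> U + V" "x \<in> U + V" using True sub UV by auto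
      then show ?thesis using subspace_diff[OF UV(1)] by blast
    next
      case False
      then show ?thesis using subspace_0[OF UV(1)] by (simp add: p_def)
    qed
    ultimately have "span B \<subseteq> {x. \<tau> x - x \<in> U + V}"
      using tp by (intro span_minimal) auto
    then show ?thesis using that sB by auto
  qed
  have pu: "\<tau> ` u = v"
  proof -
    have "\<tau> ` u = g ` u" using tp B(1) by (intro image_cong) (auto simp: p_def)
    then show ?thesis using g by (simp add: bij_betw_def)
  qed
  have pw: "\<tau> ` w = w"
  proof -
    have "\<tau> ` w = id ` w" using tp pw' B(1) by (intro image_cong) auto
    then show ?thesis by simp
  qed
  have UV': "\<tau> ` U = V"
    using t.span_image[of "w \<union> u"] b(5,6) pu pw by (simp add: image_Un)
  show ?thesis using that[OF lin inv fix_w mod UV'] by blast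
qed

text \<open>\<open>\<tau>\<close> is assumed linear on \<open>E1\<close> only, not on the ambient
  space. Injectivity preserves the cardinality of \<open>A\<close>, and cardinality determines
  dimension.\<close>

lemma linear_iso_betw_dim:
  assumes "linear_iso_betw \<tau> E1 E2" "finite E1" "A \<in> subspaces_of E1"
  shows "dim (\<tau> ` A) = dim A"
proof -
  have A: "finite A" "subspace A" "A \<subseteq> E1" "subspace (\<tau> ` A)"
    using assms linear_iso_betw_image_subspaces[OF assms(1,3)]
    by (auto simp: subspaces_of_iff intro: finite_subset)
  have "inj_on \<tau> A"
    using assms(1) A(3) by (auto simp: linear_iso_betw_def bij_betw_def intro: inj_on_subset)
  then show ?thesis using dim_eq_iff_card_eq[of "\<tau> ` A" A] A by (simp add: card_image)
qed

lemma free_separators_automorphism: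
  assumes r: "q_matroid E r" and U: "free_separator E r U" and V: "free_separator E r V"
    and dUV: "dim U = dim V"
  obtains \<tau> where "linear_iso_betw \<tau> E E" "\<tau> ` U = V" "\<And>A. A \<in> subspaces_of E \<Longrightarrow> r (\<tau> ` A) = r A"
proof -
  have fE: "finite E" "subspace E" using q_matroid_finite[OF r] .
  have Us: "U \<in> subspaces_of E" and Vs: "V \<in> subspaces_of E"
    using U V by (auto simp: free_separator_def)
  obtain \<tau> where lin: "Vector_Spaces.linear scale scale \<tau>" and inv: "\<And>x. x \<in> E \<Longrightarrow> \<tau> (\<tau> x) = x"
    and W: "\<And>x. x \<in> U \<inter> V \<Longrightarrow> \<tau> x = x" and X: "\<And>x. x \<in> E \<Longrightarrow> \<tau> x - x \<in> U + V"
    and im: "\<tau> ` U = V"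
    using subspace_swap[OF fE Us Vs dUV] by metis
  interpret t: Vector_Spaces.linear scale scale \<tau> by (rule lin)
  have XE: "U + V \<in> subspaces_of E" using subspaces_of_plus[OF fE(2) Us Vs] .
  then have sX: "subspace (U + V)" "U + V \<subseteq> E" by (auto simp: subspaces_of_iff)
  have tE: "\<tau> x \<in> E" if "x \<in> E" for x
    using subspace_add[OF fE(2), of "\<tau> x - x" x] X[OF that] sX that by auto
  have iso: "linear_iso_betw \<tau> E E"
    unfolding linear_iso_betw_def
    by (intro conjI bij_betw_byWitness[where f' = \<tau>]) (auto simp: inv tE t.add t.scale)
  have "r (\<tau> ` A) = r A" if A: "A \<in> subspaces_of E" for A
  proof -
    have AE: "A \<subseteq> E" "subspace A" using A by (auto simp: subspaces_of_iff)
    have tA: "\<tau> ` A \<in> subspaces_of E" using linear_iso_betw_image_subspaces[OF iso A] .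
    \<comment> \<open>\<open>\<tau>\<close> is its own inverse on \<open>E\<close> and fixes
      \<open>U \<inter> V\<close> pointwise, so a point of \<open>U \<inter> V\<close> has only
      itself as a preimage in \<open>E\<close>.\<close>
    have 1: "\<tau> ` A \<inter> (U \<inter> V) = A \<inter> (U \<inter> V)"
    proof (intro set_eqI iffI)
      fix y assume y: "y \<in> \<tau> ` A \<inter> (U \<inter> V)"
      then obtain x where x: "x \<in> A" "y = \<tau> x" by auto
      then have "x = \<tau> y" using inv AE by auto
      then have "x = y" using W y by auto
      then show "y \<in> A \<inter> (U \<inter> V)" using x y by auto
    next
      fix y assume "y \<in> A \<inter> (U \<inter> V)"
      then show "y \<in> \<tau> ` A \<inter> (U \<inter> V)" using W[of y] by force
    qed
    \<comment> \<open>\<open>\<tau>\<close> moves each vector of \<open>A\<close> by an element of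
      \<open>U + V\<close>, so adding \<open>U + V\<close> to \<open>A\<close> or to its image gives
      the same sum.\<close>
    have "\<tau> ` A \<subseteq> A + (U + V)"
    proof
      fix y assume "y \<in> \<tau> ` A"
      then obtain x where x: "x \<in> A" "y = \<tau> x" by auto
      then have "x + (\<tau> x - x) \<in> A + (U + V)" using X AE by (intro set_plus_intro) auto
      then show "y \<in> A + (U + V)" using x by simp
    qed
    moreover have "A \<subseteq> \<tau> ` A + (U + V)"
    proof
      fix x assume x: "x \<in> A"
      then have "\<tau> x + - (\<tau> x - x) \<in> \<tau> ` A + (U + V)"
        using X AE by (intro set_plus_intro subspace_neg sX) auto
      then show "x \<in> \<tau> ` A + (U + V)" by simp
    qed
    moreover have "subspace (\<tau> ` A)" using tA by (simp add: subspaces_of_iff)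
    ultimately have 2: "\<tau> ` A + (U + V) = A + (U + V)"
      using set_plus_subset[OF subspace_set_plus[OF AE(2) sX(1)], of "\<tau> ` A" "U + V"]
        set_plus_subset[OF subspace_set_plus[OF _ sX(1)], of "\<tau> ` A" A "U + V"]
        subset_set_plus_right[of A "U + V"] subset_set_plus_right[of "\<tau> ` A" "U + V"] AE
      by (intro subset_antisym) simp_all
    have "r (\<tau> ` A) = min (r (A \<inter> (U \<inter> V)) + int (dim A) - int (dim (A \<inter> (U \<inter> V))))
        (r (A + (U + V)))"
      using rank_of_two_free_separators[OF r U V dUV tA]
      unfolding 1 2 linear_iso_betw_dim[OF iso fE(1) A] .
    also have "\<dots> = r A" using rank_of_two_free_separators[OF r U V dUV A] by (rule sym)
    finally show ?thesis .
  qed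
  then show ?thesis using that iso im by blast
qed

section \<open>Transport of free separators along linear isomorphisms\<close>

lemma linear_iso_betw_add: "linear_iso_betw \<tau> E1 E2 \<Longrightarrow> x \<in> E1 \<Longrightarrow> y \<in> E1 \<Longrightarrow> \<tau> (x + y) = \<tau> x + \<tau> y"
  and linear_iso_betw_scale: "linear_iso_betw \<tau> E1 E2 \<Longrightarrow> x \<in> E1 \<Longrightarrow> \<tau> (scale c x) = scale c (\<tau> x)"
  and linear_iso_betw_bij: "linear_iso_betw \<tau> E1 E2 \<Longrightarrow> bij_betw \<tau> E1 E2"
  by (simp_all add: linear_iso_betw_def)

lemma linear_iso_betw_compose:
  assumes "linear_iso_betw \<sigma> E1 E2" "linear_iso_betw \<tau> E2 E3"
  shows "linear_iso_betw (\<tau> \<circ> \<sigma>) E1 E3"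
proof -
  have "bij_betw (\<tau> \<circ> \<sigma>) E1 E3"
    using assms bij_betw_trans linear_iso_betw_bij by blast
  moreover have "\<sigma> x \<in> E2" if "x \<in> E1" for x
    using assms(1) that linear_iso_betw_bij bij_betwE by blast
  ultimately show ?thesis using assms by (simp add: linear_iso_betw_def)
qed

lemma linear_iso_betw_subspaces_surj:
  assumes "linear_iso_betw \<tau> E1 E2" "subspace E1" "A \<in> subspaces_of E2"
  obtains B where "B \<in> subspaces_of E1" "A = \<tau> ` B"
proof
  let ?B = "{x \<in> E1. \<tau> x \<in> A}"
  have A: "subspace A" "A \<subseteq> E2" using assms(3) by (auto simp: subspaces_of_iff)
  have 0: "0 \<in> E1" using assms(2) by (rule subspace_0)
  have "\<tau> 0 = 0" using linear_iso_betw_scale[OF assms(1) 0, of 0] by simp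
  then have "subspace ?B"
    using A(1) assms(2) 0 by (intro subspaceI)
      (auto simp: linear_iso_betw_add[OF assms(1)] linear_iso_betw_scale[OF assms(1)]
        subspace_0 subspace_add subspace_scale)
  then show "?B \<in> subspaces_of E1" by (auto simp: subspaces_of_iff)
  have "\<tau> ` E1 = E2" using linear_iso_betw_bij[OF assms(1)] by (simp add: bij_betw_def)
  then show "A = \<tau> ` ?B" using A(2) by auto
qed

lemma linear_iso_betw_image_plus:
  assumes "linear_iso_betw \<tau> E1 E2" "A \<subseteq> E1" "B \<subseteq> E1"
  shows "\<tau> ` (A + B) = \<tau> ` A + \<tau> ` B"
proof (intro set_eqI iffI)
  fix y assume "y \<in> \<tau> ` (A + B)"
  then obtain a b where ab: "a \<in> A" "b \<in> B" "y = \<tau> (a + b)" by (auto simp: set_plus_def)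
  then have "y = \<tau> a + \<tau> b" using linear_iso_betw_add[OF assms(1)] assms(2,3) by blast
  then show "y \<in> \<tau> ` A + \<tau> ` B" using ab by auto
next
  fix y assume "y \<in> \<tau> ` A + \<tau> ` B"
  then obtain a b where ab: "a \<in> A" "b \<in> B" "y = \<tau> a + \<tau> b" by (auto simp: set_plus_def)
  then have "y = \<tau> (a + b)" using linear_iso_betw_add[OF assms(1)] assms(2,3) by (metis subsetD)
  then show "y \<in> \<tau> ` (A + B)" using ab by blast
qed

text \<open>Each ingredient of the defining equation commutes with the isomorphism: sums by
  additivity, intersections by injectivity, dimensions by \<open>linear_iso_betw_dim\<close>. Every
  subspace of \<open>E2\<close> is an image, so the equation for \<open>r1\<close> yields all cases
  for \<open>r2\<close>.\<close>

lemma free_separator_image: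
  assumes iso: "linear_iso_betw \<tau> E1 E2" and E1: "finite E1" "subspace E1"
    and eq: "\<And>A. A \<in> subspaces_of E1 \<Longrightarrow> r2 (\<tau> ` A) = r1 A"
    and U: "free_separator E1 r1 U"
  shows "free_separator E2 r2 (\<tau> ` U)"
  unfolding free_separator_def
proof (intro conjI ballI)
  have Us: "U \<in> subspaces_of E1" using U by (simp add: free_separator_def)
  show "\<tau> ` U \<in> subspaces_of E2" using linear_iso_betw_image_subspaces[OF iso Us] .
  fix A assume "A \<in> subspaces_of E2"
  then obtain B where B: "B \<in> subspaces_of E1" "A = \<tau> ` B"
    using linear_iso_betw_subspaces_surj[OF iso E1(2)] by blast
  have sub: "U \<subseteq> E1" "B \<subseteq> E1" using Us B by (auto simp: subspaces_of_iff)
  have BU: "B \<inter> U \<in> subspaces_of E1" "B + U \<in> subspaces_of E1"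
    using subspaces_of_Int[OF B(1) Us] subspaces_of_plus[OF E1(2) B(1) Us] .
  have "inj_on \<tau> E1" using linear_iso_betw_bij[OF iso] by (simp add: bij_betw_def)
  then have Int: "A \<inter> \<tau> ` U = \<tau> ` (B \<inter> U)"
    using inj_on_image_Int[of \<tau> E1 B U] sub B by simp
  have plus: "A + \<tau> ` U = \<tau> ` (B + U)"
    using linear_iso_betw_image_plus[OF iso sub(2,1)] B by simp
  show "r2 A = min (r2 (A \<inter> \<tau> ` U) + int (dim A) - int (dim (A \<inter> \<tau> ` U))) (r2 (A + \<tau> ` U))"
    unfolding Int plus unfolding B(2)
    using free_separator_rank[OF U B(1)]
    by (simp only: eq[OF BU(1)] eq[OF BU(2)] eq[OF B(1)] linear_iso_betw_dim[OF iso E1(1) BU(1)]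
      linear_iso_betw_dim[OF iso E1(1) B(1)])
qed

end

section \<open>Kernel and image of a linear map on the ground space\<close>

locale linear_on_space = finite_field_space scale
  for scale :: "'a::{field,finite} \<Rightarrow> 'b::ab_group_add \<Rightarrow> 'b" +
  fixes E :: "'b set" and \<pi> :: "'b \<Rightarrow> 'b"
  assumes finite_E: "finite E" and subspace_E: "subspace E"
    and linear_\<pi>: "Vector_Spaces.linear scale scale \<pi>"
begin

sublocale \<pi>: Vector_Spaces.linear scale scale \<pi>
  by (rule linear_\<pi>)

definition K :: "'b set" where "K = {x \<in> E. \<pi> x = 0}"

text \<open>\<open>Q\<close> plays the role of the quotient \<open>E / K\<close>. As the image of a
  map into the same ambient space it is again a subspace there, so both factors and their product
  live in one type.\<close>

definition Q :: "'b set" where "Q = \<pi> ` E"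

lemma K_in_subspaces: "K \<in> subspaces_of E"
  using subspace_inter[OF subspace_E \<pi>.subspace_kernel]
  by (auto simp: subspaces_of_iff K_def Collect_conj_eq)

lemma subspace_K: "subspace K" and K_subset: "K \<subseteq> E" and finite_K: "finite K"
  using K_in_subspaces finite_E by (auto simp: subspaces_of_iff intro: finite_subset)

lemma finite_Q: "finite Q"
  using finite_E by (simp add: Q_def)

lemma K_in_subspaces_K: "K \<in> subspaces_of K"
  using subspace_K by (simp add: subspaces_of_iff)

lemma subspaces_K_mono: "A \<in> subspaces_of K \<Longrightarrow> A \<in> subspaces_of E"
  using K_subset by (auto simp: subspaces_of_iff)

lemma Int_K_in_subspaces: "A \<in> subspaces_of E \<Longrightarrow> A \<inter> K \<in> subspaces_of K"
  using subspace_K by (auto simp: subspaces_of_iff subspace_inter)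

lemma image_in_subspaces_Q: "A \<in> subspaces_of E \<Longrightarrow> \<pi> ` A \<in> subspaces_of Q"
  by (auto simp: subspaces_of_iff Q_def \<pi>.subspace_image)

lemma dim_split:
  assumes "A \<in> subspaces_of E"
  shows "dim (\<pi> ` A) + dim (A \<inter> K) = dim A"
proof -
  have "A \<inter> K = {x \<in> A. \<pi> x = 0}" using assms by (auto simp: K_def subspaces_of_iff)
  then show ?thesis
    using dim_rank_nullity[OF linear_\<pi>, of A] assms finite_E
    by (auto simp: subspaces_of_iff intro: finite_subset)
qed

lemma image_plus: "\<pi> ` (A + B) = \<pi> ` A + \<pi> ` B"
proof (intro set_eqI iffI)
  fix y assume "y \<in> \<pi> ` (A + B)"
  then obtain a b where "a \<in> A" "b \<in> B" "y = \<pi> a + \<pi> b" by (auto simp: set_plus_def \<pi>.add)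
  then show "y \<in> \<pi> ` A + \<pi> ` B" by auto
next
  fix y assume "y \<in> \<pi> ` A + \<pi> ` B"
  then obtain a b where "a \<in> A" "b \<in> B" "y = \<pi> (a + b)" by (auto simp: set_plus_def \<pi>.add)
  then show "y \<in> \<pi> ` (A + B)" by blast
qed

lemma image_plus_K:
  assumes "A \<in> subspaces_of E"
  shows "\<pi> ` (A + K) = \<pi> ` A"
proof -
  have "subspace (\<pi> ` A)" "subspace (\<pi> ` K)"
    using assms subspace_K \<pi>.subspace_image by (auto simp: subspaces_of_iff)
  moreover have "\<pi> ` K \<subseteq> \<pi> ` A"
    using subspace_0[OF \<open>subspace (\<pi> ` A)\<close>] by (auto simp: K_def)
  ultimately show ?thesis
    unfolding image_plus by (intro set_plus_absorb)
qed

section \<open>The free product, its restriction to \<open>K\<close> and its contraction by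
  \<open>K\<close>\<close>

text \<open>The free product of \<open>r1\<close> on the kernel and \<open>r2\<close> on the image of \<open>\<pi>\<close>, the q-analogue of the
  Crapo--Schmitt free product of matroids. Both terms of the minimum are submodular and their difference is
  monotone, which makes the minimum submodular.\<close>

definition free_product :: "('b set \<Rightarrow> int) \<Rightarrow> ('b set \<Rightarrow> int) \<Rightarrow> 'b set \<Rightarrow> int" where
  "free_product r1 r2 =
     (\<lambda>A\<in>subspaces_of E. min (r1 (A \<inter> K) + int (dim (\<pi> ` A))) (r1 K + r2 (\<pi> ` A)))"

lemma free_product_rank:
  "A \<in> subspaces_of E \<Longrightarrow>
    free_product r1 r2 A = min (r1 (A \<inter> K) + int (dim (\<pi> ` A))) (r1 K + r2 (\<pi> ` A))"
  by (simp add: free_product_def)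

lemma q_matroid_free_product:
  assumes r1: "q_matroid K r1" and r2: "q_matroid Q r2"
  shows "q_matroid E (free_product r1 r2)"
proof (rule q_matroidI[OF finite_E subspace_E])
  show "free_product r1 r2 \<in> extensional (subspaces_of E)" by (simp add: free_product_def)
next
  fix A assume A: "A \<in> subspaces_of E"
  show "0 \<le> free_product r1 r2 A"
    using q_matroid_nonneg[OF r1 Int_K_in_subspaces[OF A]] q_matroid_nonneg[OF r1 K_in_subspaces_K]
      q_matroid_nonneg[OF r2 image_in_subspaces_Q[OF A]]
    unfolding free_product_rank[OF A] by linarith
  show "free_product r1 r2 A \<le> int (dim A)"
    using q_matroid_le_dim[OF r1 Int_K_in_subspaces[OF A]] dim_split[OF A]
    unfolding free_product_rank[OF A] by linarith
next
  fix A B assume A: "A \<in> subspaces_of E" and B: "B \<in> subspaces_of E" and "A \<subseteq> B"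
  have "r1 (A \<inter> K) \<le> r1 (B \<inter> K)"
    using q_matroid_mono[OF r1 Int_K_in_subspaces[OF A] Int_K_in_subspaces[OF B]] \<open>A \<subseteq> B\<close> by blast
  moreover have "r2 (\<pi> ` A) \<le> r2 (\<pi> ` B)"
    using q_matroid_mono[OF r2 image_in_subspaces_Q[OF A] image_in_subspaces_Q[OF B]] \<open>A \<subseteq> B\<close> by blast
  moreover have "dim (\<pi> ` A) \<le> dim (\<pi> ` B)"
    using image_in_subspaces_Q[OF A] image_in_subspaces_Q[OF B] finite_Q \<open>A \<subseteq> B\<close>
    by (intro dim_mono_finite) (auto simp: subspaces_of_iff intro: finite_subset)
  ultimately show "free_product r1 r2 A \<le> free_product r1 r2 B"
    unfolding free_product_rank[OF A] free_product_rank[OF B] by linarith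
next
  fix A B assume A: "A \<in> subspaces_of E" and B: "B \<in> subspaces_of E"
  define P where "P = A + B"
  define I where "I = A \<inter> B"
  have P: "P \<in> subspaces_of E" and I: "I \<in> subspaces_of E"
    using subspaces_of_plus[OF subspace_E A B] subspaces_of_Int[OF A B] by (auto simp: P_def I_def)
  note k = Int_K_in_subspaces[OF A] Int_K_in_subspaces[OF B] Int_K_in_subspaces[OF P]
    Int_K_in_subspaces[OF I]
  note q = image_in_subspaces_Q[OF A] image_in_subspaces_Q[OF B] image_in_subspaces_Q[OF P]
    image_in_subspaces_Q[OF I]
  have sub: "A \<subseteq> P" "B \<subseteq> P"
    using A B subset_set_plus_left subset_set_plus_right by (auto simp: P_def subspaces_of_iff)
  define f where "f X = r1 (X \<inter> K) + int (dim (\<pi> ` X))" for X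
  define g where "g X = r1 K + r2 (\<pi> ` X)" for X
  \<comment> \<open>By \<open>dim_split\<close>, \<open>f X\<close> is \<open>dim X\<close> minus
    the nullity of \<open>X \<inter> K\<close> in \<open>r1\<close>. Dimension is modular and
    nullity supermodular; \<open>?S\<close> may be smaller than \<open>P \<inter> K\<close>, which
    monotonicity of the nullity absorbs.\<close>
  have ff: "f P + f I \<le> f A + f B"
  proof -
    let ?S = "(A \<inter> K) + (B \<inter> K)"
    have S: "?S \<in> subspaces_of K" using subspaces_of_plus[OF subspace_K k(1,2)] .
    have SP: "?S \<subseteq> P \<inter> K"
      using sub k(3) by (intro set_plus_subset) (auto simp: subspaces_of_iff)
    have IK: "(A \<inter> K) \<inter> (B \<inter> K) = I \<inter> K" by (auto simp: I_def)
    have "r1 ?S + r1 (I \<inter> K) \<le> r1 (A \<inter> K) + r1 (B \<inter> K)"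
      using q_matroid_submodular[OF r1 k(1,2)] unfolding IK .
    moreover have "int (dim ?S) + int (dim (I \<inter> K)) = int (dim (A \<inter> K)) + int (dim (B \<inter> K))"
      using q_matroid_dim_modular[OF r1 k(1,2)] unfolding IK .
    moreover have "int (dim ?S) - r1 ?S \<le> int (dim (P \<inter> K)) - r1 (P \<inter> K)"
      using q_matroid_nullity_mono[OF r1 S k(3) SP] .
    moreover have "dim P + dim I = dim A + dim B"
      using A B finite_E unfolding P_def I_def
      by (intro dim_set_plus_Int) (auto simp: subspaces_of_iff intro: finite_subset)
    ultimately show ?thesis
      unfolding f_def using dim_split[OF A] dim_split[OF B] dim_split[OF P] dim_split[OF I]
      by linarith
  qed
  have gg: "g P + g I \<le> g A + g B"
  proof -
    have "r2 (\<pi> ` P) + r2 (\<pi> ` A \<inter> \<pi> ` B) \<le> r2 (\<pi> ` A) + r2 (\<pi> ` B)"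
      using q_matroid_submodular[OF r2 q(1,2)] unfolding P_def image_plus .
    \<comment> \<open>The image of an intersection may be smaller than the intersection of the
      images; monotonicity closes the gap.\<close>
    moreover have "r2 (\<pi> ` I) \<le> r2 (\<pi> ` A \<inter> \<pi> ` B)"
      using q_matroid_mono[OF r2 q(4) subspaces_of_Int[OF q(1,2)]] by (auto simp: I_def)
    ultimately show ?thesis by (simp add: g_def)
  qed
  \<comment> \<open>Up to the constant \<open>r1 K\<close>, the difference \<open>f X - g X\<close>
    is the rank of \<open>X \<inter> K\<close> plus the nullity of the image of \<open>X\<close>,
    and both are monotone.\<close>
  have fg: "f X - g X \<le> f P - g P" if X: "X \<in> subspaces_of E" "X \<subseteq> P" for X
  proof -
    have "r1 (X \<inter> K) \<le> r1 (P \<inter> K)"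
      using q_matroid_mono[OF r1 Int_K_in_subspaces[OF X(1)] k(3)] X(2) by blast
    moreover have "int (dim (\<pi> ` X)) - r2 (\<pi> ` X) \<le> int (dim (\<pi> ` P)) - r2 (\<pi> ` P)"
      using q_matroid_nullity_mono[OF r2 image_in_subspaces_Q[OF X(1)] q(3)] X(2) by blast
    ultimately show ?thesis by (simp add: f_def g_def)
  qed
  \<comment> \<open>If the minima for \<open>A\<close> and \<open>B\<close> are both attained by
    \<open>f\<close> or both by \<open>g\<close>, then \<open>ff\<close> or \<open>gg\<close>
    suffices. For \<open>f A + g B\<close>, bound the left side by \<open>g P + f I\<close>:
    \<open>ff\<close> gives \<open>f I \<le> f A + f B - f P\<close>, and \<open>fg\<close> for
    \<open>B\<close> turns \<open>f B - f P + g P\<close> into at most \<open>g B\<close>. The other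
    mixed case is symmetric.\<close>
  have "min (f P) (g P) + min (f I) (g I) \<le> min (f A) (g A) + min (f B) (g B)"
    using ff gg fg[OF A sub(1)] fg[OF B sub(2)] by linarith
  then show "free_product r1 r2 (A + B) + free_product r1 r2 (A \<inter> B)
      \<le> free_product r1 r2 A + free_product r1 r2 B"
    using A B P I by (simp add: free_product_rank f_def g_def P_def I_def)
qed

lemma free_product_on_K:
  assumes r1: "q_matroid K r1" and r2: "q_matroid Q r2" and A: "A \<in> subspaces_of K"
  shows "free_product r1 r2 A = r1 A"
proof -
  have "\<pi> ` A \<subseteq> {0}" using A by (auto simp: K_def subspaces_of_iff)
  moreover have "\<pi> 0 \<in> \<pi> ` A" using A by (intro imageI) (simp add: subspaces_of_iff subspace_0)
  ultimately have im: "\<pi> ` A = {0}" by auto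
  have AE: "A \<in> subspaces_of E" using subspaces_K_mono[OF A] .
  have "A \<inter> K = A" using A by (auto simp: subspaces_of_iff)
  moreover have "dim (\<pi> ` A) = 0"
    unfolding im using dim_span_eq_card_independent[OF independent_empty] by simp
  moreover have "r1 A \<le> r1 K"
    using q_matroid_mono[OF r1 A K_in_subspaces_K] A by (auto simp: subspaces_of_iff)
  moreover have "0 \<le> r2 (\<pi> ` A)" "r2 (\<pi> ` A) \<le> int (dim (\<pi> ` A))"
    using q_matroid_nonneg[OF r2] q_matroid_le_dim[OF r2] image_in_subspaces_Q[OF AE] by auto
  ultimately show ?thesis by (simp add: free_product_rank[OF AE])
qed

text \<open>Here the first term is \<open>r1 K\<close> plus the dimension of the image, and a rank
  in \<open>r2\<close> never exceeds the dimension, so the second term is the minimum.\<close>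

lemma free_product_above_K:
  assumes r2: "q_matroid Q r2" and A: "A \<in> subspaces_of E" and "K \<subseteq> A"
  shows "free_product r1 r2 A = r1 K + r2 (\<pi> ` A)"
  using q_matroid_le_dim[OF r2 image_in_subspaces_Q[OF A]] \<open>K \<subseteq> A\<close>
  by (simp add: free_product_rank[OF A] Int_absorb1)

text \<open>The two terms of the minimum defining the product are recovered by evaluating it at
  \<open>A \<inter> K\<close> and at \<open>A + K\<close>; the latter has the same image under
  \<open>\<pi>\<close> as \<open>A\<close>.\<close>

lemma free_separator_free_product:
  assumes r1: "q_matroid K r1" and r2: "q_matroid Q r2"
  shows "free_separator E (free_product r1 r2) K"
  unfolding free_separator_def
proof (intro conjI ballI)
  show "K \<in> subspaces_of E" by (rule K_in_subspaces)
  fix A assume A: "A \<in> subspaces_of E"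
  have AK: "A + K \<in> subspaces_of E" using subspaces_of_plus[OF subspace_E A K_in_subspaces] .
  have "K \<subseteq> A + K" using A subset_set_plus_right by (simp add: subspaces_of_iff)
  then have "free_product r1 r2 (A + K) = r1 K + r2 (\<pi> ` A)"
    using free_product_above_K[OF r2 AK] by (simp add: image_plus_K[OF A])
  then show "free_product r1 r2 A = min (free_product r1 r2 (A \<inter> K) + int (dim A) - int (dim (A \<inter> K)))
      (free_product r1 r2 (A + K))"
    using free_product_on_K[OF r1 r2 Int_K_in_subspaces[OF A]] dim_split[OF A]
    by (simp add: free_product_rank[OF A] flip: dim_split[OF A])
qed

section \<open>Recovering the factors from an isomorphism of free products\<close>

lemma free_product_isomorphic_fixing_K:
  assumes r1: "q_matroid K r1" and r2: "q_matroid Q r2"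
    and s1: "q_matroid K s1" and s2: "q_matroid Q s2"
    and iso: "q_matroid_isomorphic E (free_product r1 r2) E (free_product s1 s2)"
  obtains \<phi> where "linear_iso_betw \<phi> E E" "\<phi> ` K = K"
    "\<And>A. A \<in> subspaces_of E \<Longrightarrow> free_product s1 s2 (\<phi> ` A) = free_product r1 r2 A"
proof -
  obtain \<sigma> where \<sigma>: "linear_iso_betw \<sigma> E E"
    "\<And>A. A \<in> subspaces_of E \<Longrightarrow> free_product s1 s2 (\<sigma> ` A) = free_product r1 r2 A"
    using iso by (auto simp: q_matroid_isomorphic_def)
  have "free_separator E (free_product s1 s2) (\<sigma> ` K)"
    using free_separator_image[OF \<sigma>(1) finite_E subspace_E \<sigma>(2) free_separator_free_product[OF r1 r2]] .
  moreover have "dim (\<sigma> ` K) = dim K"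
    using linear_iso_betw_dim[OF \<sigma>(1) finite_E K_in_subspaces] .
  ultimately obtain \<tau> where \<tau>: "linear_iso_betw \<tau> E E" "\<tau> ` \<sigma> ` K = K"
    "\<And>A. A \<in> subspaces_of E \<Longrightarrow> free_product s1 s2 (\<tau> ` A) = free_product s1 s2 A"
    using free_separators_automorphism[OF q_matroid_free_product[OF s1 s2] _
        free_separator_free_product[OF s1 s2]] by blast
  show ?thesis
  proof
    show "linear_iso_betw (\<tau> \<circ> \<sigma>) E E" using linear_iso_betw_compose[OF \<sigma>(1) \<tau>(1)] .
    show "(\<tau> \<circ> \<sigma>) ` K = K" using \<tau>(2) by (simp add: image_comp)
    fix A assume A: "A \<in> subspaces_of E"
    have "free_product s1 s2 (\<tau> ` \<sigma> ` A) = free_product r1 r2 A"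
      using \<tau>(3)[OF linear_iso_betw_image_subspaces[OF \<sigma>(1) A]] \<sigma>(2)[OF A] by simp
    then show "free_product s1 s2 ((\<tau> \<circ> \<sigma>) ` A) = free_product r1 r2 A" by (simp add: image_comp)
  qed
qed

lemma linear_iso_betw_quotient:
  assumes \<phi>: "linear_iso_betw \<phi> E E" and K: "\<phi> ` K = K"
  obtains \<psi> where "linear_iso_betw \<psi> Q Q" "\<And>x. x \<in> E \<Longrightarrow> \<psi> (\<pi> x) = \<pi> (\<phi> x)"
proof -
  \<comment> \<open>\<open>inv_into\<close> picks some preimage in \<open>E\<close>. Any other one
    differs from it by an element of \<open>K\<close>, which \<open>\<phi>\<close> keeps in
    \<open>K\<close> and \<open>\<pi>\<close> then kills, so the choice does not affect the
    value.\<close>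
  define \<psi> where "\<psi> y = \<pi> (\<phi> (inv_into E \<pi> y))" for y
  have \<phi>E: "\<phi> ` E = E" using linear_iso_betw_bij[OF \<phi>] by (simp add: bij_betw_def)
  have \<psi>: "\<psi> (\<pi> x) = \<pi> (\<phi> x)" if x: "x \<in> E" for x
  proof -
    define z where "z = inv_into E \<pi> (\<pi> x)"
    have z: "z \<in> E" "\<pi> z = \<pi> x"
      using x by (auto simp: z_def inv_into_into f_inv_into_f)
    then have xz: "x - z \<in> K" "x - z \<in> E"
      using x subspace_diff[OF subspace_E] by (auto simp: K_def \<pi>.diff)
    then have "\<pi> (\<phi> (x - z)) = 0" using K by (auto simp: K_def)
    moreover have "\<phi> x = \<phi> (x - z) + \<phi> z" using linear_iso_betw_add[OF \<phi> xz(2) z(1)] by simp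
    ultimately show ?thesis by (simp add: \<psi>_def \<pi>.add flip: z_def)
  qed
  have "\<psi> ` Q = \<pi> ` \<phi> ` E" unfolding Q_def image_image using \<psi> by simp
  then have im: "\<psi> ` Q = Q" using \<phi>E by (simp add: Q_def)
  \<comment> \<open>A map of a finite set onto itself is injective.\<close>
  then have "inj_on \<psi> Q" using finite_Q by (intro eq_card_imp_inj_on) auto
  then have bij: "bij_betw \<psi> Q Q" using im by (simp add: bij_betw_def)
  have add: "\<psi> (x + y) = \<psi> x + \<psi> y" if xy: "x \<in> Q" "y \<in> Q" for x y
  proof -
    obtain a b where ab: "a \<in> E" "b \<in> E" "x = \<pi> a" "y = \<pi> b" using xy by (auto simp: Q_def)
    then have "\<psi> (\<pi> (a + b)) = \<pi> (\<phi> a) + \<pi> (\<phi> b)"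
      using \<psi>[OF subspace_add[OF subspace_E ab(1,2)]] linear_iso_betw_add[OF \<phi> ab(1,2)]
      by (simp add: \<pi>.add)
    then show ?thesis using ab \<psi> by (simp add: \<pi>.add)
  qed
  have scale: "\<psi> (scale c x) = scale c (\<psi> x)" if x: "x \<in> Q" for c x
  proof -
    obtain a where a: "a \<in> E" "x = \<pi> a" using x by (auto simp: Q_def)
    then have "\<psi> (\<pi> (scale c a)) = scale c (\<pi> (\<phi> a))"
      using \<psi>[OF subspace_scale[OF subspace_E a(1)]] linear_iso_betw_scale[OF \<phi> a(1)]
      by (simp add: \<pi>.scale)
    then show ?thesis using a \<psi> by (simp add: \<pi>.scale)
  qed
  show ?thesis using that[of \<psi>] bij add scale \<psi> by (simp add: linear_iso_betw_def)
qed

lemma isomorphic_factors: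
  assumes r1: "q_matroid K r1" and r2: "q_matroid Q r2"
    and s1: "q_matroid K s1" and s2: "q_matroid Q s2"
    and iso: "q_matroid_isomorphic E (free_product r1 r2) E (free_product s1 s2)"
  shows "q_matroid_isomorphic K r1 K s1" "q_matroid_isomorphic Q r2 Q s2"
proof -
  obtain \<phi> where \<phi>: "linear_iso_betw \<phi> E E" "\<phi> ` K = K"
    and eq: "\<And>A. A \<in> subspaces_of E \<Longrightarrow> free_product s1 s2 (\<phi> ` A) = free_product r1 r2 A"
    using free_product_isomorphic_fixing_K[OF assms] by blast
  have \<phi>K: "linear_iso_betw \<phi> K K"
    using \<phi>(1) K_subset bij_betw_subset[OF linear_iso_betw_bij[OF \<phi>(1)] K_subset \<phi>(2)]
    unfolding linear_iso_betw_def by blast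
  have 1: "s1 (\<phi> ` A) = r1 A" if A: "A \<in> subspaces_of K" for A
    using eq[OF subspaces_K_mono[OF A]] free_product_on_K[OF r1 r2 A]
      free_product_on_K[OF s1 s2 linear_iso_betw_image_subspaces[OF \<phi>K A]] by simp
  then show "q_matroid_isomorphic K r1 K s1"
    using \<phi>K by (auto simp: q_matroid_isomorphic_def)
  obtain \<psi> where \<psi>: "linear_iso_betw \<psi> Q Q" "\<And>x. x \<in> E \<Longrightarrow> \<psi> (\<pi> x) = \<pi> (\<phi> x)"
    using linear_iso_betw_quotient[OF \<phi>] by blast
  have "s2 (\<psi> ` V) = r2 V" if V: "V \<in> subspaces_of Q" for V
  proof -
    \<comment> \<open>The full preimage of \<open>V\<close> contains \<open>K\<close>, and so does
      its image under \<open>\<phi>\<close>, so both products are evaluated by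
      \<open>free_product_above_K\<close>.\<close>
    define A where "A = {x \<in> E. \<pi> x \<in> V}"
    have sV: "subspace V" "V \<subseteq> Q" using V by (auto simp: subspaces_of_iff)
    have A: "A \<in> subspaces_of E"
      using subspace_inter[OF subspace_E \<pi>.subspace_linear_preimage[OF sV(1)]]
      by (auto simp: A_def subspaces_of_iff Collect_conj_eq)
    have KA: "K \<subseteq> A" using subspace_0[OF sV(1)] by (auto simp: A_def K_def)
    have \<pi>A: "\<pi> ` A = V" using sV(2) by (auto simp: A_def Q_def)
    have "\<psi> ` V = (\<lambda>x. \<psi> (\<pi> x)) ` A" unfolding \<pi>A[symmetric] by (rule image_image)
    also have "\<dots> = \<pi> ` \<phi> ` A" unfolding image_image using \<psi>(2) by (auto simp: A_def)
    finally have im: "\<pi> ` \<phi> ` A = \<psi> ` V" by simp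
    have "K \<subseteq> \<phi> ` A" using \<phi>(2) KA by blast
    then have "s1 K + s2 (\<psi> ` V) = r1 K + r2 V"
      using eq[OF A] free_product_above_K[OF r2 A KA]
        free_product_above_K[OF s2 linear_iso_betw_image_subspaces[OF \<phi>(1) A]] im \<pi>A by simp
    \<comment> \<open>The additive constants cancel: \<open>s1 K = r1 K\<close> is the restriction
      identity at \<open>K\<close> itself.\<close>
    then show ?thesis using 1[OF K_in_subspaces_K] \<phi>(2) by simp
  qed
  then show "q_matroid_isomorphic Q r2 Q s2"
    using \<psi>(1) by (auto simp: q_matroid_isomorphic_def)
qed

section \<open>Counting isomorphism classes\<close>

text \<open>Send a pair of classes to the class of the free product of chosen representatives. If
  two pairs have the same image, the products are isomorphic, hence by
  \<open>isomorphic_factors\<close> so are the representatives, and the pairs agree. An injection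
  into a finite set gives the inequality.\<close>

theorem card_q_matroid_iso_classes_mult_le:
  "card (q_matroid_iso_classes K) * card (q_matroid_iso_classes Q) \<le> card (q_matroid_iso_classes E)"
proof -
  define R where "R F = {(r, s). q_matroid F r \<and> q_matroid F s \<and> q_matroid_isomorphic F r F s}" for F
  have cl: "q_matroid_iso_classes F = {r. q_matroid F r} // R F" for F
    by (simp add: q_matroid_iso_classes_def R_def)
  have eqv: "equiv {r. q_matroid F r} (R F)" for F
    unfolding R_def by (rule equiv_q_matroid_isomorphic)
  define rep where "rep X = (SOME r. r \<in> X)" for X :: "('b set \<Rightarrow> int) set"
  have rep: "rep X \<in> X" "q_matroid F (rep X)" if X: "X \<in> q_matroid_iso_classes F" for F X
  proof -
    show 1: "rep X \<in> X"
      using in_quotient_imp_non_empty[OF eqv X[unfolded cl]] by (auto simp: rep_def some_in_eq)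
    show "q_matroid F (rep X)"
      using in_quotient_imp_subset[OF eqv X[unfolded cl]] 1 by blast
  qed
  define \<Phi> where "\<Phi> = (\<lambda>(X, Y). R E `` {free_product (rep X) (rep Y)})"
  have "inj_on \<Phi> (q_matroid_iso_classes K \<times> q_matroid_iso_classes Q)"
  proof (rule inj_onI, clarify)
    fix X Y X' Y'
    assume X: "X \<in> q_matroid_iso_classes K" "X' \<in> q_matroid_iso_classes K"
      and Y: "Y \<in> q_matroid_iso_classes Q" "Y' \<in> q_matroid_iso_classes Q"
      and eq: "\<Phi> (X, Y) = \<Phi> (X', Y')"
    have "(free_product (rep X) (rep Y), free_product (rep X') (rep Y')) \<in> R E"
      using eq rep X Y q_matroid_free_product
      by (simp add: \<Phi>_def eq_equiv_class_iff[OF eqv])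
    then have "q_matroid_isomorphic E (free_product (rep X) (rep Y)) E (free_product (rep X') (rep Y'))"
      by (simp add: R_def)
    then have "(rep X, rep X') \<in> R K" "(rep Y, rep Y') \<in> R Q"
      using isomorphic_factors[OF rep(2)[OF X(1)] rep(2)[OF Y(1)] rep(2)[OF X(2)] rep(2)[OF Y(2)]]
        rep(2) X Y by (auto simp: R_def)
    then show "X = X' \<and> Y = Y'"
      using quotient_eqI[OF eqv X[unfolded cl]] quotient_eqI[OF eqv Y[unfolded cl]] rep(1) X Y by blast
  qed
  moreover have "\<Phi> ` (q_matroid_iso_classes K \<times> q_matroid_iso_classes Q) \<subseteq> q_matroid_iso_classes E"
    using rep q_matroid_free_product by (auto simp: \<Phi>_def cl[of E] intro!: quotientI)
  ultimately have "card (q_matroid_iso_classes K \<times> q_matroid_iso_classes Q)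
      \<le> card (q_matroid_iso_classes E)"
    using card_inj_on_le finite_q_matroid_iso_classes[OF finite_E] by blast
  then show ?thesis by (simp add: card_cartesian_product)
qed

end

section \<open>Specialization to coordinate spaces\<close>

theorem corollary4p36:
  fixes q n n1 n2 :: nat
  assumes "q = CARD('a::{field,finite})" and "n = n1 + n2"
  shows "card (q_matroid_classes TYPE('a) n)
    \<ge> card (q_matroid_classes TYPE('a) n1) * card (q_matroid_classes TYPE('a) n2)"
proof -
  \<comment> \<open>The shift that drops the first \<open>n1\<close> coordinates: on
    \<open>coord_space n\<close> its kernel is \<open>coord_space n1\<close> and its image is
    \<open>coord_space n2\<close>.\<close>
  define \<pi> :: "(nat \<Rightarrow> 'a) \<Rightarrow> nat \<Rightarrow> 'a" where "\<pi> v = (\<lambda>i. v (i + n1))" for v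
  have lin: "Vector_Spaces.linear seq_scale seq_scale \<pi>"
    unfolding Vector_Spaces.linear_iff
    by (auto simp: \<pi>_def seq_scale_def seq.vector_space_axioms)
  have sub: "seq.subspace (coord_space n :: (nat \<Rightarrow> 'a) set)"
    using coord_space_eq_span by (metis seq.subspace_span)
  interpret linear_on_space seq_scale "coord_space n" \<pi>
    by (intro linear_on_space.intro linear_on_space_axioms.intro)
      (fact seq.finite_field_space_axioms finite_coord_space sub lin)+
  have "K = coord_space n1"
    unfolding K_def
  proof (intro set_eqI iffI)
    fix v assume "v \<in> {v \<in> coord_space n. \<pi> v = 0}"
    then have "\<pi> v = 0" by simp
    then have shift: "v (i + n1) = 0" for i by (simp add: \<pi>_def fun_eq_iff)
    have "v i = 0" if "n1 \<le> i" for i using shift[of "i - n1"] that by simp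
    then show "v \<in> coord_space n1" by (simp add: coord_space_def)
  qed (auto simp: coord_space_def \<pi>_def assms(2) fun_eq_iff)
  moreover have "Q = coord_space n2"
    unfolding Q_def
  proof (intro set_eqI iffI)
    fix w :: "nat \<Rightarrow> 'a" assume w: "w \<in> coord_space n2"
    \<comment> \<open>A preimage of \<open>w\<close> under the shift: \<open>n1\<close> zeros
      followed by \<open>w\<close>, supported below \<open>n1 + n2\<close>.\<close>
    let ?v = "\<lambda>i. if i < n1 then 0 else w (i - n1)"
    have "?v \<in> coord_space n" "w = \<pi> ?v"
      using w by (auto simp: coord_space_def \<pi>_def assms(2))
    then show "w \<in> \<pi> ` coord_space n" by blast
  qed (auto simp: coord_space_def \<pi>_def assms(2))
  ultimately show ?thesis
    using card_q_matroid_iso_classes_mult_le by (simp add: q_matroid_classes_def)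
qed

end
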